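(* Let $D_1\in\mathbb{R}^{n\times m_1}$ and $D_i\in\mathbb{R}^{m_{i-1}\times m_i}$ ($2\le i\le k$), and let $x=D_1\gamma_1$, $\gamma_{i-1}=D_i\gamma_i$ ($2\le i\le k$), where $\gamma_i\in\mathbb{R}^{m_i}$ has support $\Lambda_i$ of cardinality $s_i$. Let $y=x+e$ with $e\sim\mathcal{N}(0,\sigma^2 I)$. Assume the RIP constants satisfy $\delta_{s_j}^{D_j}<1$ for all $1\le j\le k$. Let $\hat\gamma_1,\dots,\hat\gamma_k$ be the layer-wise oracle estimators. Then for every $1\le i\le k$, $$ \sigma^2 s_i\,\frac{1}{1+\delta_{s_1}^{D_1}}\prod_{j=2}^{i}\frac{\frac{s_{j-1}}{m_{j-1}}-\delta_{s_{j-1},s_j}^{D_j}}{\left(1+\delta_{s_j}^{D_j}\right)^2} \;\le\;\mathbb{E}\,\|\gamma_i-\hat\gamma_i\|_2^2\;\le\; \sigma^2 s_i\,\frac{1}{1-\delta_{s_1}^{D_1}}\prod_{j=2}^{i}\frac{\frac{s_{j-1}}{m_{j-1}}+\delta_{s_{j-1},s_j}^{D_j}}{\left(1-\delta_{s_j}^{D_j}\right)^2}. $$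
   Context: Notation. For a vector $v$ and index set $\Lambda$, $v^{\Lambda}$ is the restriction of $v$ to $\Lambda$. For a matrix $D$, $D^{\Lambda_c}$ is the submatrix of columns indexed by $\Lambda_c$, and $D^{\Lambda_r,\Lambda_c}$ is the submatrix with rows $\Lambda_r$ and columns $\Lambda_c$. $A^\dagger$ is the Moore–Penrose pseudo-inverse. Empty products equal $1$. RIP constant: $\delta_s^D$ is the smallest $\delta\ge 0$ such that $(1-\delta)\|v\|_2^2\le\|D^{\Lambda}v\|_2^2\le(1+\delta)\|v\|_2^2$ for every set $\Lambda$ of $s$ columns and every $v\in\mathbb{R}^s$. Subset RIP constant: for $D\in\mathbb{R}^{n\times m}$, $\delta_{s_R,s_C}^D$ is the minimum constant such that for every subset $\Lambda_R$ of $s_R$ rows, every subset $\Lambda_C$ of $s_C$ columns and all vectors $v\in\mathbb{R}^{s_C}$, $$\left(\tfrac{s_R}{n}-\delta_{s_R,s_C}^D\right)\|v\|_2^2\le\|D^{\Lambda_R,\Lambda_C}v\|_2^2\le\left(\tfrac{s_R}{n}+\delta_{s_R,s_C}^D\right)\|v\|_2^2 .$$ Layer-wise oracle estimators (the true supports $\Lambda_1,\dots,\Lambda_k$ are known): set $\hat\gamma_0=y$; for $i=1,\dots,k$, $\hat\gamma_i\in\mathbb{R}^{m_i}$ vanishes outside $\Lambda_i$ and $$\hat\gamma_i^{\Lambda_i}=\left(D_i^{\Lambda_i}\right)^{\dagger}\hat\gamma_{i-1}=\left((D_i^{\Lambda_i})^TD_i^{\Lambda_i}\right)^{-1}(D_i^{\Lambda_i})^T\hat\gamma_{i-1}.$$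 The expectation is over the noise $e$; $x$ and the $\gamma_i$ are fixed.
   Formalization: The lower bound is proved only when every factor s_{j-1}/m_{j-1} − δ_{s_{j-1},s_j} (2≤j≤i) is nonnegative or their product is ≤ 0; with two negative factors it can fail for i ≥ 3. The upper bound is unconditional. *)

theory Defs
  imports
    "HOL-Probability.Probability"
    "Jordan_Normal_Form.DL_Submatrix"
begin

text \<open>Matrices and vectors are those of Jordan Normal Form, since the layer dimensions vary with
  the layer. Row and column indices start at 0; layers are numbered from 1.\<close>

definition sq_l2_norm :: "real vec \<Rightarrow> real" where
  "sq_l2_norm v = (\<Sum>l<dim_vec v. (v $ l)\<^sup>2)"

definition supp_vec :: "real vec \<Rightarrow> nat set" where
  "supp_vec v = {l. l < dim_vec v \<and> v $ l \<noteq> 0}"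

text \<open>\<^term>\<open>pick L r\<close> is the \<^term>\<open>r\<close>-th smallest element of \<^term>\<open>L\<close>; the same enumeration is used
  by \<^const>\<open>submatrix\<close>.\<close>
definition restrict_vec :: "real vec \<Rightarrow> nat set \<Rightarrow> real vec" where
  "restrict_vec v L = vec (card {l. l < dim_vec v \<and> l \<in> L}) (\<lambda>r. v $ pick L r)"

definition col_submatrix :: "real mat \<Rightarrow> nat set \<Rightarrow> real mat" where
  "col_submatrix A L = submatrix A UNIV L"

text \<open>The Penrose conditions.\<close>
definition is_pseudo_inverse :: "real mat \<Rightarrow> real mat \<Rightarrow> bool" where
  "is_pseudo_inverse A X \<longleftrightarrow>
     X \<in> carrier_mat (dim_col A) (dim_row A) \<and>
     A * X * A = A \<and> X * A * X = X \<and>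
     transpose_mat (A * X) = A * X \<and> transpose_mat (X * A) = X * A"

definition pseudo_inverse :: "real mat \<Rightarrow> real mat" where
  "pseudo_inverse A = (THE X. is_pseudo_inverse A X)"

definition rip_const :: "real mat \<Rightarrow> nat \<Rightarrow> real" where
  "rip_const A s = (LEAST \<delta>. 0 \<le> \<delta> \<and>
     (\<forall>L v. L \<subseteq> {..<dim_col A} \<and> card L = s \<and> v \<in> carrier_vec s \<longrightarrow>
        (1 - \<delta>) * sq_l2_norm v \<le> sq_l2_norm (col_submatrix A L *\<^sub>v v) \<and>
        sq_l2_norm (col_submatrix A L *\<^sub>v v) \<le> (1 + \<delta>) * sq_l2_norm v))"

text \<open>The quantity \<open>sR / dim_row A - subset_rip_const A sR sC\<close> can be negative. A product of two such
  negative quantities is positive, but then it need not bound an estimation error from below; this is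
  why the lower bound of the theorem excludes a positive product with negative factors.
  In dimension 16, let \<open>D\<^sub>1\<close> be the identity, \<open>D\<^sub>2\<close> block diagonal with a normalised 4 x 4 Hadamard
  block (first columns (1,1,1,1)/2 and (1,1,-1,-1)/2) and an identity block, \<open>D\<^sub>3\<close> the first two
  columns of the identity, and \<open>\<gamma>\<^sub>3 = (1,1)\<close>: all supports are the first two indices, both factors are -3/4 and all RIP constants are 0. The product formula then gives
  \<open>9/8 \<sigma>\<^sup>2\<close>, whereas the expected error at the third layer is \<open>\<sigma>\<^sup>2\<close>.\<close>
definition subset_rip_const :: "real mat \<Rightarrow> nat \<Rightarrow> nat \<Rightarrow> real" where
  "subset_rip_const A sR sC = (LEAST \<delta>.
     (\<forall>R C v. R \<subseteq> {..<dim_row A} \<and> card R = sR \<and>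
              C \<subseteq> {..<dim_col A} \<and> card C = sC \<and> v \<in> carrier_vec sC \<longrightarrow>
        (real sR / real (dim_row A) - \<delta>) * sq_l2_norm v \<le> sq_l2_norm (submatrix A R C *\<^sub>v v) \<and>
        sq_l2_norm (submatrix A R C *\<^sub>v v) \<le> (real sR / real (dim_row A) + \<delta>) * sq_l2_norm v))"

text \<open>\<^term>\<open>e\<close> is distributed as N(0, \<open>\<sigma>\<^sup>2\<close> I) on \<open>\<real>\<^sup>n\<close>; note that \<^const>\<open>normal_density\<close> takes the
  standard deviation.\<close>
definition white_gaussian :: "'a measure \<Rightarrow> nat \<Rightarrow> real \<Rightarrow> ('a \<Rightarrow> real vec) \<Rightarrow> bool" where
  "white_gaussian M n \<sigma> e \<longleftrightarrow>
     (\<forall>\<omega>\<in>space M. e \<omega> \<in> carrier_vec n) \<and>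
     prob_space.indep_vars M (\<lambda>_. borel) (\<lambda>l \<omega>. e \<omega> $ l) {..<n} \<and>
     (\<forall>l<n. distributed M lborel (\<lambda>\<omega>. e \<omega> $ l) (normal_density 0 \<sigma>))"

definition oracle_estimators ::
  "nat \<Rightarrow> (nat \<Rightarrow> real mat) \<Rightarrow> (nat \<Rightarrow> nat set) \<Rightarrow> real vec \<Rightarrow> (nat \<Rightarrow> real vec) \<Rightarrow> bool" where
  "oracle_estimators k D \<Lambda> y g \<longleftrightarrow>
     g 0 = y \<and>
     (\<forall>i\<in>{1..k}. g i \<in> carrier_vec (dim_col (D i)) \<and>
        supp_vec (g i) \<subseteq> \<Lambda> i \<and>
        restrict_vec (g i) (\<Lambda> i) = pseudo_inverse (col_submatrix (D i) (\<Lambda> i)) *\<^sub>v g (i - 1))"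

end

theory Submission
  imports Defs "Jordan_Normal_Form.Determinant"
begin

text \<open>Let \<open>A\<^sub>i\<close> be the columns of \<open>D\<^sub>i\<close> indexed by \<open>\<Lambda>\<^sub>i\<close> and \<open>\<epsilon>\<^sub>i\<close> the error of layer \<open>i\<close> on \<open>\<Lambda>\<^sub>i\<close>.
  The normal equation gives \<open>\<epsilon>\<^sub>i = A\<^sub>i\<^sup>\<dagger> \<epsilon>\<^sub>i\<^sub>-\<^sub>1\<close>. Hence, if \<open>A\<^sub>i\<^sup>T A\<^sub>i w = u\<close>, then \<open>\<langle>u, \<epsilon>\<^sub>i\<rangle> = \<langle>A\<^sub>i w, \<epsilon>\<^sub>i\<^sub>-\<^sub>1\<rangle> = \<langle>S w, \<epsilon>\<^sub>i\<^sub>-\<^sub>1\<rangle>\<close>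
  where \<open>S\<close> consists of the rows of \<open>A\<^sub>i\<close> in the support \<open>\<Lambda>\<^sub>i\<^sub>-\<^sub>1\<close>. The RIP constant compares \<open>|w|\<close> with \<open>|u|\<close>, the
  subset RIP constant compares \<open>|S w|\<close> with \<open>|w|\<close>, so every linear functional of \<open>\<epsilon>\<^sub>i\<close> is a functional
  \<open>\<langle>c, e\<rangle>\<close> of the noise with two-sided bounds on \<open>|c|\<^sup>2\<close>. Its second moment is \<open>\<sigma>\<^sup>2 |c|\<^sup>2\<close>; summing over the
  coordinate functionals produces the factor \<open>s\<^sub>i\<close>. Working with functionals instead of operator norms
  treats both bounds at once.\<close>

unbundle no inner_syntax

section \<open>Gram matrices and the pseudo-inverse\<close>

lemma sq_l2_norm_scalar_prod: "sq_l2_norm v = v \<bullet> v"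
  by (simp add: sq_l2_norm_def scalar_prod_def power2_eq_square atLeast0LessThan)

lemma sq_l2_norm_nonneg: "0 \<le> sq_l2_norm v"
  by (simp add: sq_l2_norm_def sum_nonneg)

lemma sq_l2_norm_eq_0_iff:
  assumes "v \<in> carrier_vec d"
  shows "sq_l2_norm v = 0 \<longleftrightarrow> v = 0\<^sub>v d"
  using assms by (auto simp: sq_l2_norm_def sum_nonneg_eq_0_iff intro!: eq_vecI)

lemma scalar_prod_Cauchy_Schwarz:
  fixes v w :: "real vec"
  assumes "v \<in> carrier_vec d" "w \<in> carrier_vec d"
  shows "(v \<bullet> w)\<^sup>2 \<le> sq_l2_norm v * sq_l2_norm w"
  using Cauchy_Schwarz_ineq_sum[of "\<lambda>l. v $ l" "\<lambda>l. w $ l" "{0..<d}"] assms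
  by (simp add: sq_l2_norm_def scalar_prod_def atLeast0LessThan)

lemma scalar_prod_gram:
  fixes A :: "real mat"
  assumes "A \<in> carrier_mat r d" "u \<in> carrier_vec d" "w \<in> carrier_vec d"
  shows "u \<bullet> (transpose_mat A *\<^sub>v (A *\<^sub>v w)) = (A *\<^sub>v u) \<bullet> (A *\<^sub>v w)"
proof -
  have c: "transpose_mat A *\<^sub>v (A *\<^sub>v w) \<in> carrier_vec d" "A *\<^sub>v w \<in> carrier_vec r" "A *\<^sub>v u \<in> carrier_vec r"
    using assms by (auto intro!: mult_mat_vec_carrier)
  have "u \<bullet> (transpose_mat A *\<^sub>v (A *\<^sub>v w)) = (transpose_mat A *\<^sub>v (A *\<^sub>v w)) \<bullet> u"
    by (rule comm_scalar_prod[OF assms(2) c(1)])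
  also have "\<dots> = (A *\<^sub>v w) \<bullet> (A *\<^sub>v u)"
    by (rule transpose_vec_mult_scalar[OF assms(1,2) c(2)])
  also have "\<dots> = (A *\<^sub>v u) \<bullet> (A *\<^sub>v w)"
    by (rule comm_scalar_prod[OF c(2,3)])
  finally show ?thesis .
qed

text \<open>This is the lower RIP inequality for one fixed column submatrix, used below with
  \<open>a = 1 - \<delta> i\<close>. Positivity of \<open>a\<close> makes \<open>A\<close>
  injective, and this is what turns the pseudo-inverse into a left inverse.\<close>

locale bounded_below_mat =
  fixes A :: "real mat" and r d :: nat and a :: real
  assumes A: "A \<in> carrier_mat r d"
    and a_pos: "0 < a"
    and lower: "\<And>v. v \<in> carrier_vec d \<Longrightarrow> a * sq_l2_norm v \<le> sq_l2_norm (A *\<^sub>v v)"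
begin

lemma mult_vec_eq_0:
  assumes v: "v \<in> carrier_vec d" and "A *\<^sub>v v = 0\<^sub>v r"
  shows "v = 0\<^sub>v d"
proof -
  have "a * sq_l2_norm v \<le> 0"
    using lower[OF v] assms(2) sq_l2_norm_eq_0_iff[of "0\<^sub>v r" r] by simp
  then have "sq_l2_norm v = 0"
    using a_pos sq_l2_norm_nonneg[of v] by (simp add: mult_le_0_iff)
  then show ?thesis using sq_l2_norm_eq_0_iff[OF v] by simp
qed

text \<open>A kernel vector \<open>v\<close> of the Gram matrix satisfies |A v|^2 = <v, A^T A v> = 0
  and hence vanishes, so the determinant is nonzero. The inverse is symmetric because its transpose
  is a left inverse of the symmetric Gram matrix, and a left inverse coincides with the right
  inverse \<open>B\<close>.\<close>

lemma gram_inverse: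
  obtains B where "B \<in> carrier_mat d d" "B * (transpose_mat A * A) = 1\<^sub>m d"
    "(transpose_mat A * A) * B = 1\<^sub>m d" "transpose_mat B = B"
proof -
  let ?G = "transpose_mat A * A"
  have G: "?G \<in> carrier_mat d d" using A by auto
  have At: "transpose_mat A \<in> carrier_mat d r" using A by auto
  have "det ?G \<noteq> 0"
  proof
    assume "det ?G = 0"
    then obtain v where v: "v \<in> carrier_vec d" "v \<noteq> 0\<^sub>v d" "?G *\<^sub>v v = 0\<^sub>v d"
      using det_0_iff_vec_prod_zero[OF G] by blast
    have Av: "A *\<^sub>v v \<in> carrier_vec r" using A v(1) by (rule mult_mat_vec_carrier)
    have "transpose_mat A *\<^sub>v (A *\<^sub>v v) = 0\<^sub>v d"
      using v(3) assoc_mult_mat_vec[OF At A v(1)] by simp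
    then have "sq_l2_norm (A *\<^sub>v v) = 0"
      using scalar_prod_gram[OF A v(1) v(1)] v(1) by (simp add: sq_l2_norm_scalar_prod)
    then have "A *\<^sub>v v = 0\<^sub>v r" using sq_l2_norm_eq_0_iff[OF Av] by simp
    with mult_vec_eq_0[OF v(1)] v(2) show False by simp
  qed
  from det_non_zero_imp_unit[OF G this, of "()"]
  obtain B where B: "B \<in> carrier_mat d d" "B * ?G = 1\<^sub>m d" "?G * B = 1\<^sub>m d"
    unfolding Units_def ring_mat_simps by auto
  have Gt: "transpose_mat ?G = ?G" using transpose_mult[OF At A] by simp
  have Bt: "transpose_mat B \<in> carrier_mat d d" using B by simp
  have "transpose_mat B * ?G = transpose_mat (?G * B)"
    using transpose_mult[OF G B(1)] Gt by simp
  then have 1: "transpose_mat B * ?G = 1\<^sub>m d" using B by simp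
  have "transpose_mat B = transpose_mat B * (?G * B)" using B Bt by simp
  also have "\<dots> = (transpose_mat B * ?G) * B" using assoc_mult_mat[OF Bt G B(1)] by simp
  finally have "transpose_mat B = B" using 1 B by simp
  with B that show thesis by blast
qed

text \<open>Since \<open>pseudo_inverse\<close> is a definite description, existence and uniqueness
  come first. The candidate is B A^T with B the inverse Gram matrix. Conversely, if Y satisfies the
  Penrose conditions, transposing A Y A = A and using the symmetry of A Y gives A^T A Y = A^T;
  multiplying by B yields Y = B A^T.\<close>

lemma pseudo_inverse_carrier: "pseudo_inverse A \<in> carrier_mat d r"
  and pseudo_inverse_normal_equation:
    "transpose_mat A * (A * pseudo_inverse A) = transpose_mat A"
proof -
  let ?At = "transpose_mat A"
  have At: "?At \<in> carrier_mat d r" using A by auto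
  obtain B where B: "B \<in> carrier_mat d d" "B * (?At * A) = 1\<^sub>m d" "(?At * A) * B = 1\<^sub>m d"
    "transpose_mat B = B" by (rule gram_inverse)
  let ?X = "B * ?At"
  have X: "?X \<in> carrier_mat d r" using B At by auto
  have normal: "?At * (A * Y) = ?At" if "is_pseudo_inverse A Y" for Y
  proof -
    have Y: "Y \<in> carrier_mat d r" "A * Y * A = A" "transpose_mat (A * Y) = A * Y"
      using that A unfolding is_pseudo_inverse_def by auto
    have AY: "A * Y \<in> carrier_mat r r" using A Y by auto
    have "?At = transpose_mat (A * Y * A)" using Y by simp
    also have "\<dots> = ?At * transpose_mat (A * Y)" by (rule transpose_mult[OF AY A])
    finally show ?thesis using Y by simp
  qed
  have uniq: "Y = ?X" if "is_pseudo_inverse A Y" for Y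
  proof -
    have Y: "Y \<in> carrier_mat d r" using that A unfolding is_pseudo_inverse_def by auto
    have "Y = (B * (?At * A)) * Y" using B Y by simp
    also have "\<dots> = B * ((?At * A) * Y)" using assoc_mult_mat[OF B(1) _ Y, of "?At * A"] A by auto
    also have "(?At * A) * Y = ?At * (A * Y)" by (rule assoc_mult_mat[OF At A Y])
    finally show ?thesis using normal[OF that] by simp
  qed
  have XA: "?X * A = 1\<^sub>m d" using assoc_mult_mat[OF B(1) At A] B by simp
  have AX: "A * ?X \<in> carrier_mat r r" using A X by auto
  have "is_pseudo_inverse A ?X"
    unfolding is_pseudo_inverse_def
  proof (intro conjI)
    show "?X \<in> carrier_mat (dim_col A) (dim_row A)" using X A by simp
    show "A * ?X * A = A" using assoc_mult_mat[OF A X A] XA A by simp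
    show "?X * A * ?X = ?X" by (simp only: XA left_mult_one_mat[OF X])
    show "transpose_mat (?X * A) = ?X * A" using XA by simp
    have "transpose_mat (A * ?X) = transpose_mat ?X * ?At" by (rule transpose_mult[OF A X])
    also have "transpose_mat ?X = A * B" using transpose_mult[OF B(1) At] B by simp
    also have "A * B * ?At = A * ?X" by (rule assoc_mult_mat[OF A B(1) At])
    finally show "transpose_mat (A * ?X) = A * ?X" .
  qed
  then have "is_pseudo_inverse A (pseudo_inverse A)"
    unfolding pseudo_inverse_def by (rule theI) (rule uniq)
  then show "pseudo_inverse A \<in> carrier_mat d r" "?At * (A * pseudo_inverse A) = ?At"
    using normal A unfolding is_pseudo_inverse_def by auto
qed

text \<open>All four estimates come from the identities <w, u> = |A w|^2 and <A u, A w> = |u|^2,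
  combined with Cauchy-Schwarz and the two-sided bound on \<open>A\<close>. The pair comparing |w|
  with |u| serves the layers from the second on; the pair comparing |A w| with |u| serves the first
  layer.\<close>

lemma gram_solution:
  assumes u: "u \<in> carrier_vec d"
    and b: "0 < b" "\<And>v. v \<in> carrier_vec d \<Longrightarrow> sq_l2_norm (A *\<^sub>v v) \<le> b * sq_l2_norm v"
  obtains w where "w \<in> carrier_vec d" "transpose_mat A *\<^sub>v (A *\<^sub>v w) = u"
    "a\<^sup>2 * sq_l2_norm w \<le> sq_l2_norm u" "sq_l2_norm u \<le> b\<^sup>2 * sq_l2_norm w"
    "a * sq_l2_norm (A *\<^sub>v w) \<le> sq_l2_norm u" "sq_l2_norm u \<le> b * sq_l2_norm (A *\<^sub>v w)"
proof -
  have At: "transpose_mat A \<in> carrier_mat d r" using A by auto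
  obtain B where B: "B \<in> carrier_mat d d" "(transpose_mat A * A) * B = 1\<^sub>m d" by (rule gram_inverse)
  define w where "w = B *\<^sub>v u"
  have w: "w \<in> carrier_vec d" unfolding w_def using B(1) u by (rule mult_mat_vec_carrier)
  have "(transpose_mat A * A) *\<^sub>v w = ((transpose_mat A * A) * B) *\<^sub>v u"
    unfolding w_def using B u A by (intro assoc_mult_mat_vec[symmetric]) auto
  then have eq: "transpose_mat A *\<^sub>v (A *\<^sub>v w) = u"
    using B u assoc_mult_mat_vec[OF At A w] by simp
  have c: "A *\<^sub>v w \<in> carrier_vec r" "A *\<^sub>v u \<in> carrier_vec r"
    using A w u by (auto intro: mult_mat_vec_carrier)
  let ?W = "sq_l2_norm w" and ?U = "sq_l2_norm u" and ?Q = "sq_l2_norm (A *\<^sub>v w)"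
  have nn: "0 \<le> ?W" "0 \<le> ?U" "0 \<le> ?Q" by (auto intro: sq_l2_norm_nonneg)
  have Q: "w \<bullet> u = ?Q"
    using scalar_prod_gram[OF A w w] eq by (simp add: sq_l2_norm_scalar_prod)
  have U: "(A *\<^sub>v u) \<bullet> (A *\<^sub>v w) = ?U"
    using scalar_prod_gram[OF A u w] eq by (simp add: sq_l2_norm_scalar_prod)
  \<comment> \<open>One factor \<open>?U\<close> is cancelled at the end of this chain; when it is
    0, the claim is only that \<open>b * ?Q\<close> is nonnegative. The chain for \<open>?Q\<close>
    is treated in the same way.\<close>
  have "?U * ?U \<le> sq_l2_norm (A *\<^sub>v u) * ?Q"
    using scalar_prod_Cauchy_Schwarz[OF c(2,1)] U by (simp add: power2_eq_square)
  also have "\<dots> \<le> b * ?U * ?Q" by (intro mult_right_mono b(2)[OF u] nn)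
  finally have UQ: "?U \<le> b * ?Q"
    using nn b(1) by (cases "?U = 0") (auto simp: mult_ac)
  have "a * (?Q * ?Q) \<le> a * (?W * ?U)"
    using scalar_prod_Cauchy_Schwarz[OF w u] Q a_pos by (simp add: power2_eq_square)
  also have "\<dots> \<le> ?Q * ?U" using mult_right_mono[OF lower[OF w] nn(2)] by (simp add: mult_ac)
  finally have QU: "a * ?Q \<le> ?U"
    using nn a_pos by (cases "?Q = 0") (auto simp: mult_ac)
  have "a * (a * ?W) \<le> a * ?Q" using lower[OF w] a_pos by (intro mult_left_mono) auto
  then have 1: "a\<^sup>2 * ?W \<le> ?U" using QU by (simp add: power2_eq_square mult_ac)
  have "b * ?Q \<le> b * (b * ?W)" using b(2)[OF w] b(1) by (intro mult_left_mono) auto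
  then have 2: "?U \<le> b\<^sup>2 * ?W" using UQ by (simp add: power2_eq_square mult_ac)
  show thesis by (rule that[OF w eq 1 2 QU UQ])
qed

text \<open>\<^term>\<open>pseudo_inverse A *\<^sub>v z\<close> satisfies the normal equation; pairing it with a vector of the
  form \<open>A\<^sup>T A w\<close> therefore moves the inner product to the preceding layer.\<close>

lemma scalar_prod_pseudo_inverse:
  assumes "w \<in> carrier_vec d" "z \<in> carrier_vec r"
  shows "(transpose_mat A *\<^sub>v (A *\<^sub>v w)) \<bullet> (pseudo_inverse A *\<^sub>v z) = (A *\<^sub>v w) \<bullet> z"
proof -
  let ?P = "pseudo_inverse A"
  note P = pseudo_inverse_carrier
  have At: "transpose_mat A \<in> carrier_mat d r" using A by auto
  have Pz: "?P *\<^sub>v z \<in> carrier_vec d" using P assms(2) by (rule mult_mat_vec_carrier)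
  have APz: "A *\<^sub>v (?P *\<^sub>v z) \<in> carrier_vec r" using A Pz by (rule mult_mat_vec_carrier)
  have Aw: "A *\<^sub>v w \<in> carrier_vec r" using A assms(1) by (rule mult_mat_vec_carrier)
  have AP: "A * ?P \<in> carrier_mat r r" using A P by auto
  have "transpose_mat A *\<^sub>v (A *\<^sub>v (?P *\<^sub>v z)) = (transpose_mat A * (A * ?P)) *\<^sub>v z"
    using assoc_mult_mat_vec[OF At AP assms(2)] assoc_mult_mat_vec[OF A P assms(2)] by simp
  then have normal: "transpose_mat A *\<^sub>v (A *\<^sub>v (?P *\<^sub>v z)) = transpose_mat A *\<^sub>v z"
    using pseudo_inverse_normal_equation by simp
  have "(transpose_mat A *\<^sub>v (A *\<^sub>v w)) \<bullet> (?P *\<^sub>v z) = (A *\<^sub>v w) \<bullet> (A *\<^sub>v (?P *\<^sub>v z))"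
    by (rule transpose_vec_mult_scalar[OF A Pz Aw])
  also have "\<dots> = (A *\<^sub>v (?P *\<^sub>v z)) \<bullet> (A *\<^sub>v w)" by (rule comm_scalar_prod[OF Aw APz])
  also have "\<dots> = (transpose_mat A *\<^sub>v (A *\<^sub>v (?P *\<^sub>v z))) \<bullet> w"
    by (rule transpose_vec_mult_scalar[OF A assms(1) APz, symmetric])
  also have "\<dots> = (transpose_mat A *\<^sub>v z) \<bullet> w" using normal by simp
  also have "\<dots> = z \<bullet> (A *\<^sub>v w)" by (rule transpose_vec_mult_scalar[OF A assms])
  also have "\<dots> = (A *\<^sub>v w) \<bullet> z" by (rule comm_scalar_prod[OF assms(2) Aw])
  finally show ?thesis .
qed

text \<open>Multiplying the normal equation by the inverse Gram matrix B gives P = B A^T for the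
  pseudo-inverse P, so P A = 1. Thus a noise-free input is decoded exactly, and only the error of
  the input propagates.\<close>

lemma pseudo_inverse_mult_vec:
  assumes "v \<in> carrier_vec d"
  shows "pseudo_inverse A *\<^sub>v (A *\<^sub>v v) = v"
proof -
  let ?P = "pseudo_inverse A"
  have At: "transpose_mat A \<in> carrier_mat d r" using A by auto
  obtain B where B: "B \<in> carrier_mat d d" "B * (transpose_mat A * A) = 1\<^sub>m d" by (rule gram_inverse)
  have P: "?P \<in> carrier_mat d r" by (rule pseudo_inverse_carrier)
  have "?P = (B * (transpose_mat A * A)) * ?P" using B P by simp
  also have "\<dots> = B * (transpose_mat A * A * ?P)"
    using A by (intro assoc_mult_mat[OF B(1) _ P]) auto
  also have "transpose_mat A * A * ?P = transpose_mat A * (A * ?P)" by (rule assoc_mult_mat[OF At A P])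
  also have "\<dots> = transpose_mat A" by (rule pseudo_inverse_normal_equation)
  finally have "?P * A = 1\<^sub>m d" using assoc_mult_mat[OF B(1) At A] B by simp
  then show ?thesis using assoc_mult_mat_vec[OF P A assms] assms by simp
qed

end

section \<open>Restriction to an index set\<close>

text \<open>Surjectivity follows by counting: the image lies in \<open>L\<close> and, by
  injectivity, has as many elements as \<open>L\<close>.\<close>

lemma bij_betw_pick:
  assumes "finite L"
  shows "bij_betw (pick L) {..<card L} L"
proof -
  have inj: "inj_on (pick L) {..<card L}"
  proof (rule inj_onI)
    fix p q assume "p \<in> {..<card L}" "q \<in> {..<card L}" "pick L p = pick L q"
    then show "p = q" by (metis card_pick_le lessThan_iff)
  qed
  have "pick L ` {..<card L} \<subseteq> L" using pick_in_set_le by auto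
  moreover have "card (pick L ` {..<card L}) = card L" using card_image[OF inj] by simp
  ultimately have "pick L ` {..<card L} = L" using assms by (intro card_subset_eq) auto
  with inj show ?thesis unfolding bij_betw_def by simp
qed

lemma sum_pick:
  assumes "finite L"
  shows "(\<Sum>r<card L. f (pick L r)) = (\<Sum>l\<in>L. f l)"
  by (rule sum.reindex_bij_betw[OF bij_betw_pick[OF assms]])

lemma Collect_less_subset: "L \<subseteq> {..<d} \<Longrightarrow> {l. l < d \<and> l \<in> L} = (L :: nat set)"
  by auto

lemma restrict_vec_eq:
  assumes "v \<in> carrier_vec d" "L \<subseteq> {..<d}"
  shows "restrict_vec v L = vec (card L) (\<lambda>r. v $ pick L r)"
  unfolding restrict_vec_def carrier_vecD[OF assms(1)] Collect_less_subset[OF assms(2)] ..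

lemma restrict_vec_carrier:
  assumes "v \<in> carrier_vec d" "L \<subseteq> {..<d}"
  shows "restrict_vec v L \<in> carrier_vec (card L)"
  unfolding restrict_vec_eq[OF assms] by (rule vec_carrier)

lemma restrict_vec_index:
  assumes "v \<in> carrier_vec d" "L \<subseteq> {..<d}" "r < card L"
  shows "restrict_vec v L $ r = v $ pick L r"
  unfolding restrict_vec_eq[OF assms(1,2)] by (rule index_vec[OF assms(3)])

lemma restrict_vec_minus:
  assumes "v \<in> carrier_vec d" "w \<in> carrier_vec d" "L \<subseteq> {..<d}"
  shows "restrict_vec (v - w) L = restrict_vec v L - restrict_vec w L"
proof (rule eq_vecI)
  have c: "v - w \<in> carrier_vec d" using assms by simp
  note R = restrict_vec_carrier[OF c assms(3)] restrict_vec_carrier[OF assms(1,3)]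
    restrict_vec_carrier[OF assms(2,3)]
  then show "dim_vec (restrict_vec (v - w) L) = dim_vec (restrict_vec v L - restrict_vec w L)"
    by simp
  fix r assume "r < dim_vec (restrict_vec v L - restrict_vec w L)"
  then have r: "r < card L" using R by simp
  have "pick L r < d" using pick_in_set_le[OF r] assms(3) by auto
  then show "restrict_vec (v - w) L $ r = (restrict_vec v L - restrict_vec w L) $ r"
    using restrict_vec_index[OF c assms(3) r] restrict_vec_index[OF assms(1,3) r]
      restrict_vec_index[OF assms(2,3) r] R r assms(1,2) by simp
qed

text \<open>One factor supported in \<open>L\<close> suffices, because it annihilates the entries of
  the other outside \<open>L\<close>. In the layer step the supported factor is the preceding error,
  while \<open>v\<close> is an arbitrary vector in the range of the column submatrix.\<close>

lemma scalar_prod_restrict_vec: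
  assumes "v \<in> carrier_vec d" "w \<in> carrier_vec d" "L \<subseteq> {..<d}" "supp_vec w \<subseteq> L"
  shows "restrict_vec v L \<bullet> restrict_vec w L = v \<bullet> w"
proof -
  have fin: "finite L" using assms(3) finite_subset by blast
  have "restrict_vec v L \<bullet> restrict_vec w L = (\<Sum>r<card L. v $ pick L r * w $ pick L r)"
    using restrict_vec_carrier[OF assms(2,3)] restrict_vec_index[OF assms(1,3)]
      restrict_vec_index[OF assms(2,3)]
    by (simp add: scalar_prod_def atLeast0LessThan)
  also have "\<dots> = (\<Sum>l\<in>L. v $ l * w $ l)" by (rule sum_pick[OF fin])
  also have "\<dots> = (\<Sum>l<d. v $ l * w $ l)"
    using assms by (intro sum.mono_neutral_left) (auto simp: supp_vec_def)
  finally show ?thesis using assms(2) by (simp add: scalar_prod_def atLeast0LessThan)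
qed

lemma sq_l2_norm_restrict_vec:
  assumes "v \<in> carrier_vec d" "L \<subseteq> {..<d}" "supp_vec v \<subseteq> L"
  shows "sq_l2_norm (restrict_vec v L) = sq_l2_norm v"
  unfolding sq_l2_norm_scalar_prod using assms by (intro scalar_prod_restrict_vec) auto

lemma submatrix_carrier:
  assumes "A \<in> carrier_mat r d" "R \<subseteq> {..<r}" "C \<subseteq> {..<d}"
  shows "submatrix A R C \<in> carrier_mat (card R) (card C)"
  using assms by (intro carrier_matI) (auto simp: dim_submatrix Collect_less_subset)

text \<open>Reduces products with submatrices, row by row, to scalar products of restricted
  vectors.\<close>

lemma row_submatrix:
  assumes "A \<in> carrier_mat r d" "R \<subseteq> {..<r}" "C \<subseteq> {..<d}" "p < card R"
  shows "row (submatrix A R C) p = restrict_vec (row A (pick R p)) C"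
proof (rule eq_vecI)
  have i: "pick R p < r" using pick_in_set_le[OF assms(4)] assms(2) by auto
  have c: "row A (pick R p) \<in> carrier_vec d" using assms(1) i by auto
  note S = submatrix_carrier[OF assms(1-3)]
  show "dim_vec (row (submatrix A R C) p) = dim_vec (restrict_vec (row A (pick R p)) C)"
    using S restrict_vec_carrier[OF c assms(3)] by simp
  fix q assume "q < dim_vec (restrict_vec (row A (pick R p)) C)"
  then have q: "q < card C" using restrict_vec_carrier[OF c assms(3)] by simp
  have j: "pick C q < d" using pick_in_set_le[OF q] assms(3) by auto
  have "submatrix A R C $$ (p, q) = A $$ (pick R p, pick C q)"
    using assms q by (intro submatrix_index) (auto simp: Collect_less_subset)
  then show "row (submatrix A R C) p $ q = restrict_vec (row A (pick R p)) C $ q"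
    using restrict_vec_index[OF c assms(3) q] S assms(1,4) i j q by simp
qed

lemma pick_lessThan: "i < d \<Longrightarrow> pick {..<d} i = i"
  using pick_reduce_set[of i d UNIV] by (simp add: lessThan_def pick_UNIV)

text \<open>Replacing the row set \<open>UNIV\<close> by the actual row indices makes column
  submatrices an instance of the lemmas that assume \<open>R \<subseteq> {..<r}\<close>.\<close>

lemma col_submatrix_eq_submatrix: "col_submatrix A C = submatrix A {..<dim_row A} C"
proof -
  have "pick UNIV i = pick {..<dim_row A} i" if "i < dim_row A" for i
    using that by (simp only: pick_lessThan pick_UNIV)
  then show ?thesis
    unfolding col_submatrix_def submatrix_def
    by (intro eq_matI) auto
qed

lemma col_submatrix_carrier:
  assumes "A \<in> carrier_mat r d" "C \<subseteq> {..<d}"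
  shows "col_submatrix A C \<in> carrier_mat r (card C)"
  using submatrix_carrier[OF assms(1) _ assms(2), of "{..<r}"] assms(1)
  by (simp add: col_submatrix_eq_submatrix)

lemma col_submatrix_mult_restrict_vec:
  assumes "A \<in> carrier_mat r d" "C \<subseteq> {..<d}" "v \<in> carrier_vec d" "supp_vec v \<subseteq> C"
  shows "col_submatrix A C *\<^sub>v restrict_vec v C = A *\<^sub>v v"
proof (rule eq_vecI)
  note S = col_submatrix_carrier[OF assms(1,2)]
  show "dim_vec (col_submatrix A C *\<^sub>v restrict_vec v C) = dim_vec (A *\<^sub>v v)"
    using S assms(1) by simp
  fix i assume "i < dim_vec (A *\<^sub>v v)"
  then have i: "i < r" using assms(1) by simp
  have "row (col_submatrix A C) i = restrict_vec (row A i) C"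
    using row_submatrix[OF assms(1) _ assms(2), of "{..<r}" i] i assms(1)
    by (simp add: col_submatrix_eq_submatrix pick_lessThan)
  then show "(col_submatrix A C *\<^sub>v restrict_vec v C) $ i = (A *\<^sub>v v) $ i"
    using scalar_prod_restrict_vec[of "row A i" d v C] assms S i by auto
qed

text \<open>This is where the subset RIP constant becomes applicable: it controls the part of
  \<open>col_submatrix A C *\<^sub>v w\<close> that lies on the support of the preceding
  layer.\<close>

lemma submatrix_mult_vec:
  assumes "A \<in> carrier_mat r d" "R \<subseteq> {..<r}" "C \<subseteq> {..<d}" "w \<in> carrier_vec (card C)"
  shows "submatrix A R C *\<^sub>v w = restrict_vec (col_submatrix A C *\<^sub>v w) R"
proof (rule eq_vecI)
  note S = submatrix_carrier[OF assms(1-3)] col_submatrix_carrier[OF assms(1,3)]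
  have c: "col_submatrix A C *\<^sub>v w \<in> carrier_vec r"
    using S(2) assms(4) by (rule mult_mat_vec_carrier)
  note T = restrict_vec_carrier[OF c assms(2)]
  show "dim_vec (submatrix A R C *\<^sub>v w) = dim_vec (restrict_vec (col_submatrix A C *\<^sub>v w) R)"
    using S T by simp
  fix p assume "p < dim_vec (restrict_vec (col_submatrix A C *\<^sub>v w) R)"
  then have p: "p < card R" using T by simp
  have i: "pick R p < r" using pick_in_set_le[OF p] assms(2) by auto
  have "row (col_submatrix A C) (pick R p) = row (submatrix A R C) p"
    using row_submatrix[OF assms(1) _ assms(3), of "{..<r}" "pick R p"]
      row_submatrix[OF assms(1-3) p] i assms(1)
    by (simp add: col_submatrix_eq_submatrix pick_lessThan)
  then show "(submatrix A R C *\<^sub>v w) $ p = restrict_vec (col_submatrix A C *\<^sub>v w) R $ p"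
    using restrict_vec_index[OF c assms(2) p] S p i by simp
qed

section \<open>The RIP constants are attained\<close>

text \<open>\<open>LEAST\<close> on the reals carries information only if a minimum exists. A
  nonempty closed set that is bounded below contains its infimum, which is therefore the least
  element.\<close>

lemma LeastI_closed_real:
  fixes P :: "real \<Rightarrow> bool"
  assumes "closed {x. P x}" "P a" "\<And>x. P x \<Longrightarrow> b \<le> x"
  shows "P (LEAST x. P x)"
proof -
  have bdd: "bdd_below {x. P x}" using assms(3) by (intro bdd_belowI[of _ b]) auto
  have "Inf {x. P x} \<in> {x. P x}"
    using assms(1,2) bdd by (intro closed_contains_Inf) auto
  moreover have "Inf {x. P x} \<le> y" if "P y" for y
    using that bdd by (intro cInf_lower) auto
  ultimately show ?thesis using Least_equality[of P "Inf {x. P x}"] by simp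
qed

text \<open>Cauchy-Schwarz in every row bounds the operator norm by the Frobenius norm of the
  submatrix, hence by that of \<open>A\<close>. The bound is uniform in \<open>R\<close> and
  \<open>C\<close> and so supplies an admissible constant for both RIP definitions.\<close>

lemma sq_l2_norm_submatrix_mult_vec_le:
  assumes A: "A \<in> carrier_mat r d" and R: "R \<subseteq> {..<r}" and C: "C \<subseteq> {..<d}"
    and w: "w \<in> carrier_vec (card C)"
  shows "sq_l2_norm (submatrix A R C *\<^sub>v w) \<le> (\<Sum>i<r. \<Sum>j<d. (A $$ (i, j))\<^sup>2) * sq_l2_norm w"
proof -
  have fin: "finite R" "finite C" using R C finite_subset by blast+
  note S = submatrix_carrier[OF A R C]
  have row: "(row (submatrix A R C) p \<bullet> w)\<^sup>2 \<le> (\<Sum>j<d. (A $$ (pick R p, j))\<^sup>2) * sq_l2_norm w"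
    if p: "p < card R" for p
  proof -
    have i: "pick R p < r" using pick_in_set_le[OF p] R by auto
    have c: "row A (pick R p) \<in> carrier_vec d" using A i by auto
    have "sq_l2_norm (restrict_vec (row A (pick R p)) C) = (\<Sum>q<card C. (row A (pick R p) $ pick C q)\<^sup>2)"
      using restrict_vec_carrier[OF c C] restrict_vec_index[OF c C] by (simp add: sq_l2_norm_def)
    also have "\<dots> = (\<Sum>j\<in>C. (row A (pick R p) $ j)\<^sup>2)" by (rule sum_pick[OF fin(2)])
    also have "\<dots> \<le> (\<Sum>j<d. (row A (pick R p) $ j)\<^sup>2)" using C by (intro sum_mono2) auto
    also have "\<dots> = (\<Sum>j<d. (A $$ (pick R p, j))\<^sup>2)" using A i by (intro sum.cong) auto
    finally have "sq_l2_norm (row (submatrix A R C) p) \<le> (\<Sum>j<d. (A $$ (pick R p, j))\<^sup>2)"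
      using row_submatrix[OF A R C p] by simp
    then have "sq_l2_norm (row (submatrix A R C) p) * sq_l2_norm w
        \<le> (\<Sum>j<d. (A $$ (pick R p, j))\<^sup>2) * sq_l2_norm w"
      by (intro mult_right_mono sq_l2_norm_nonneg)
    moreover have "(row (submatrix A R C) p \<bullet> w)\<^sup>2 \<le> sq_l2_norm (row (submatrix A R C) p) * sq_l2_norm w"
      using S w p by (intro scalar_prod_Cauchy_Schwarz) auto
    ultimately show ?thesis by linarith
  qed
  have "sq_l2_norm (submatrix A R C *\<^sub>v w) = (\<Sum>p<card R. (row (submatrix A R C) p \<bullet> w)\<^sup>2)"
    using S by (simp add: sq_l2_norm_def)
  also have "\<dots> \<le> (\<Sum>p<card R. (\<Sum>j<d. (A $$ (pick R p, j))\<^sup>2) * sq_l2_norm w)"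
    using row by (intro sum_mono) auto
  also have "\<dots> = (\<Sum>p<card R. \<Sum>j<d. (A $$ (pick R p, j))\<^sup>2) * sq_l2_norm w"
    by (simp add: sum_distrib_right)
  also have "(\<Sum>p<card R. \<Sum>j<d. (A $$ (pick R p, j))\<^sup>2) = (\<Sum>i\<in>R. \<Sum>j<d. (A $$ (i, j))\<^sup>2)"
    by (rule sum_pick[OF fin(1)])
  also have "(\<Sum>i\<in>R. \<Sum>j<d. (A $$ (i, j))\<^sup>2) * sq_l2_norm w
      \<le> (\<Sum>i<r. \<Sum>j<d. (A $$ (i, j))\<^sup>2) * sq_l2_norm w"
    using R by (intro mult_right_mono sum_mono2 sq_l2_norm_nonneg) (auto intro: sum_nonneg)
  finally show ?thesis .
qed

lemma rip_const_bounds: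
  assumes A: "A \<in> carrier_mat r d"
  shows rip_const_nonneg: "0 \<le> rip_const A s"
    and rip_const_lower: "\<And>L v. L \<subseteq> {..<d} \<Longrightarrow> card L = s \<Longrightarrow> v \<in> carrier_vec s \<Longrightarrow>
      (1 - rip_const A s) * sq_l2_norm v \<le> sq_l2_norm (col_submatrix A L *\<^sub>v v)"
    and rip_const_upper: "\<And>L v. L \<subseteq> {..<d} \<Longrightarrow> card L = s \<Longrightarrow> v \<in> carrier_vec s \<Longrightarrow>
      sq_l2_norm (col_submatrix A L *\<^sub>v v) \<le> (1 + rip_const A s) * sq_l2_norm v"
proof -
  define P where "P \<delta> \<longleftrightarrow> 0 \<le> \<delta> \<and>
     (\<forall>L (v :: real vec). L \<subseteq> {..<dim_col A} \<and> card L = s \<and> v \<in> carrier_vec s \<longrightarrow>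
        (1 - \<delta>) * sq_l2_norm v \<le> sq_l2_norm (col_submatrix A L *\<^sub>v v) \<and>
        sq_l2_norm (col_submatrix A L *\<^sub>v v) \<le> (1 + \<delta>) * sq_l2_norm v)" for \<delta> :: real
  \<comment> \<open>The premises of the implication do not depend on \<open>\<delta>\<close>, so
    each instance is a constant condition or a pair of closed linear inequalities in
    \<open>\<delta>\<close>; the set is an intersection of these.\<close>
  have "closed {\<delta>. P \<delta>}"
    unfolding P_def
    by (intro closed_Collect_conj closed_Collect_all closed_Collect_imp open_Collect_const
        closed_Collect_le continuous_intros)
  moreover define K where "K = (\<Sum>i<r. \<Sum>j<d. (A $$ (i, j))\<^sup>2)"
  have K: "0 \<le> K" unfolding K_def by (intro sum_nonneg) auto
  \<comment> \<open>The summand 1 makes the lower inequality trivial, its coefficient being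
    \<open>- K\<close>; the upper inequality is the Frobenius bound.\<close>
  have "P (1 + K)"
    unfolding P_def
  proof (intro conjI allI impI)
    show "0 \<le> 1 + K" using K by simp
    fix L and v :: "real vec" assume *: "L \<subseteq> {..<dim_col A} \<and> card L = s \<and> v \<in> carrier_vec s"
    have "(1 - (1 + K)) * sq_l2_norm v \<le> 0"
      using K sq_l2_norm_nonneg[of v] by (simp add: mult_le_0_iff)
    then show "(1 - (1 + K)) * sq_l2_norm v \<le> sq_l2_norm (col_submatrix A L *\<^sub>v v)"
      using sq_l2_norm_nonneg[of "col_submatrix A L *\<^sub>v v"] by linarith
    have "sq_l2_norm (col_submatrix A L *\<^sub>v v) \<le> K * sq_l2_norm v"
      unfolding K_def col_submatrix_eq_submatrix
      using * A by (intro sq_l2_norm_submatrix_mult_vec_le) auto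
    also have "\<dots> \<le> (1 + (1 + K)) * sq_l2_norm v"
      by (intro mult_right_mono sq_l2_norm_nonneg) auto
    finally show "sq_l2_norm (col_submatrix A L *\<^sub>v v) \<le> (1 + (1 + K)) * sq_l2_norm v" .
  qed
  moreover have "0 \<le> \<delta>" if "P \<delta>" for \<delta> using that unfolding P_def by simp
  ultimately have "P (LEAST \<delta>. P \<delta>)" by (rule LeastI_closed_real)
  then have *: "P (rip_const A s)" unfolding rip_const_def P_def .
  show "0 \<le> rip_const A s" using * unfolding P_def by simp
  show "(1 - rip_const A s) * sq_l2_norm v \<le> sq_l2_norm (col_submatrix A L *\<^sub>v v)"
    "sq_l2_norm (col_submatrix A L *\<^sub>v v) \<le> (1 + rip_const A s) * sq_l2_norm v"
    if "L \<subseteq> {..<d}" "card L = s" "v \<in> carrier_vec s" for L v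
    using * that A unfolding P_def by auto
qed

text \<open>For \<open>sC = 0\<close> there is no least constant, so that \<^const>\<open>subset_rip_const\<close> is unspecified.\<close>

lemma subset_rip_const_bounds:
  assumes A: "A \<in> carrier_mat r d" and sR: "sR \<le> r" and sC: "1 \<le> sC" "sC \<le> d"
  shows subset_rip_const_lower: "\<And>R C v. R \<subseteq> {..<r} \<Longrightarrow> card R = sR \<Longrightarrow> C \<subseteq> {..<d} \<Longrightarrow>
      card C = sC \<Longrightarrow> v \<in> carrier_vec sC \<Longrightarrow>
      (real sR / real r - subset_rip_const A sR sC) * sq_l2_norm v \<le> sq_l2_norm (submatrix A R C *\<^sub>v v)"
    and subset_rip_const_upper: "\<And>R C v. R \<subseteq> {..<r} \<Longrightarrow> card R = sR \<Longrightarrow> C \<subseteq> {..<d} \<Longrightarrow>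
      card C = sC \<Longrightarrow> v \<in> carrier_vec sC \<Longrightarrow>
      sq_l2_norm (submatrix A R C *\<^sub>v v) \<le> (real sR / real r + subset_rip_const A sR sC) * sq_l2_norm v"
    and subset_rip_const_upper_nonneg: "0 \<le> real sR / real r + subset_rip_const A sR sC"
proof -
  define P where "P \<delta> \<longleftrightarrow>
     (\<forall>R C (v :: real vec). R \<subseteq> {..<dim_row A} \<and> card R = sR \<and>
              C \<subseteq> {..<dim_col A} \<and> card C = sC \<and> v \<in> carrier_vec sC \<longrightarrow>
        (real sR / real (dim_row A) - \<delta>) * sq_l2_norm v \<le> sq_l2_norm (submatrix A R C *\<^sub>v v) \<and>
        sq_l2_norm (submatrix A R C *\<^sub>v v) \<le> (real sR / real (dim_row A) + \<delta>) * sq_l2_norm v)"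
    for \<delta> :: real
  let ?q = "real sR / real r"
  have q: "0 \<le> ?q" by simp
  have "closed {\<delta>. P \<delta>}"
    unfolding P_def
    by (intro closed_Collect_conj closed_Collect_all closed_Collect_imp open_Collect_const
        closed_Collect_le continuous_intros)
  moreover define K where "K = (\<Sum>i<r. \<Sum>j<d. (A $$ (i, j))\<^sup>2)"
  have K: "0 \<le> K" unfolding K_def by (intro sum_nonneg) auto
  \<comment> \<open>Here the ratio \<open>?q\<close> takes the place of 1, so the lower coefficient
    is again \<open>- K\<close>.\<close>
  have "P (?q + K)"
    unfolding P_def
  proof (intro conjI allI impI)
    fix R C and v :: "real vec" assume *: "R \<subseteq> {..<dim_row A} \<and> card R = sR \<and>
              C \<subseteq> {..<dim_col A} \<and> card C = sC \<and> v \<in> carrier_vec sC"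
    have dr: "dim_row A = r" using A by simp
    have "(?q - (?q + K)) * sq_l2_norm v \<le> 0"
      using K sq_l2_norm_nonneg[of v] by (simp add: mult_le_0_iff)
    then show "(real sR / real (dim_row A) - (?q + K)) * sq_l2_norm v \<le> sq_l2_norm (submatrix A R C *\<^sub>v v)"
      using sq_l2_norm_nonneg[of "submatrix A R C *\<^sub>v v"] unfolding dr by linarith
    have "sq_l2_norm (submatrix A R C *\<^sub>v v) \<le> K * sq_l2_norm v"
      unfolding K_def using * A by (intro sq_l2_norm_submatrix_mult_vec_le) auto
    also have "\<dots> \<le> (?q + (?q + K)) * sq_l2_norm v"
      using q by (intro mult_right_mono sq_l2_norm_nonneg) linarith
    finally show "sq_l2_norm (submatrix A R C *\<^sub>v v) \<le> (real sR / real (dim_row A) + (?q + K)) * sq_l2_norm v"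
      unfolding dr .
  qed
  \<comment> \<open>The definition imposes no sign on the constant, so the lower bound on admissible
    values is obtained by testing with a unit vector. This needs a submatrix of the prescribed size
    and at least one column.\<close>
  moreover have low: "- ?q \<le> \<delta>" if "P \<delta>" for \<delta>
  proof -
    let ?v = "unit_vec sC 0 :: real vec"
    have "0 \<le> sq_l2_norm (submatrix A {..<sR} {..<sC} *\<^sub>v ?v)" by (rule sq_l2_norm_nonneg)
    also have "\<dots> \<le> (?q + \<delta>) * sq_l2_norm ?v"
      using that A sR sC unfolding P_def by auto
    also have "sq_l2_norm ?v = 1"
      using sC by (simp add: sq_l2_norm_scalar_prod)
    finally show ?thesis by simp
  qed
  ultimately have "P (LEAST \<delta>. P \<delta>)" by (rule LeastI_closed_real)
  then have *: "P (subset_rip_const A sR sC)" unfolding subset_rip_const_def P_def .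
  show "0 \<le> ?q + subset_rip_const A sR sC" using low[OF *] by linarith
  show "(?q - subset_rip_const A sR sC) * sq_l2_norm v \<le> sq_l2_norm (submatrix A R C *\<^sub>v v)"
    "sq_l2_norm (submatrix A R C *\<^sub>v v) \<le> (?q + subset_rip_const A sR sC) * sq_l2_norm v"
    if "R \<subseteq> {..<r}" "card R = sR" "C \<subseteq> {..<d}" "card C = sC" "v \<in> carrier_vec sC" for R C v
    using * that A unfolding P_def by auto
qed

section \<open>Second moments of linear functionals of the noise\<close>

text \<open>Expanding the square leaves only the diagonal terms, each contributing the variance.
  Consequently a functional of the noise enters the error bounds through the norm of its coefficient
  vector alone.\<close>

lemma white_gaussian_second_moment:
  assumes M: "prob_space M" and \<sigma>: "0 < \<sigma>" and e: "white_gaussian M n \<sigma> e" and c: "c \<in> carrier_vec n"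
  shows white_gaussian_integrable: "integrable M (\<lambda>\<omega>. (c \<bullet> e \<omega>)\<^sup>2)"
    and white_gaussian_expectation:
      "prob_space.expectation M (\<lambda>\<omega>. (c \<bullet> e \<omega>)\<^sup>2) = \<sigma>\<^sup>2 * sq_l2_norm c"
proof -
  interpret prob_space M by (rule M)
  define X where "X l \<omega> = e \<omega> $ l" for l \<omega>
  have indep: "indep_vars (\<lambda>_. borel) X {..<n}"
    and D: "\<And>l. l < n \<Longrightarrow> distributed M lborel (X l) (normal_density 0 \<sigma>)"
    and ec: "\<And>\<omega>. \<omega> \<in> space M \<Longrightarrow> e \<omega> \<in> carrier_vec n"
    using e unfolding white_gaussian_def X_def by auto
  have int1: "integrable M (X l)" and E1: "expectation (X l) = 0"
    and int2: "integrable M (\<lambda>\<omega>. (X l \<omega>)\<^sup>2)" and E2: "expectation (\<lambda>\<omega>. (X l \<omega>)\<^sup>2) = \<sigma>\<^sup>2"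
    if l: "l < n" for l
  proof -
    show "integrable M (X l)"
      using distributed_integrable[OF D[OF l], of "\<lambda>x. x"] integrable_normal_moment_nz_1[OF \<sigma>, of 0]
      by simp
    show E: "expectation (X l) = 0" by (rule normal_distributed_expectation[OF \<sigma> D[OF l]])
    show "integrable M (\<lambda>\<omega>. (X l \<omega>)\<^sup>2)"
      using distributed_integrable[OF D[OF l], of "\<lambda>x. x\<^sup>2"] integrable_normal_moment[OF \<sigma>, of 0 2]
      by simp
    show "expectation (\<lambda>\<omega>. (X l \<omega>)\<^sup>2) = \<sigma>\<^sup>2"
      using normal_distributed_variance[OF \<sigma> D[OF l]] E by simp
  qed
  have int: "integrable M (\<lambda>\<omega>. X l \<omega> * X l' \<omega>)"
    and E: "expectation (\<lambda>\<omega>. X l \<omega> * X l' \<omega>) = (if l = l' then \<sigma>\<^sup>2 else 0)"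
    if l: "l < n" "l' < n" for l l'
  proof -
    have "integrable M (\<lambda>\<omega>. X l \<omega> * X l' \<omega>) \<and>
        expectation (\<lambda>\<omega>. X l \<omega> * X l' \<omega>) = (if l = l' then \<sigma>\<^sup>2 else 0)"
    proof (cases "l = l'")
      case True
      then show ?thesis using int2[OF l(1)] E2[OF l(1)] by (simp add: power2_eq_square)
    next
      \<comment> \<open>Independence of the pair factors the expectation of the product, and both
        means are 0.\<close>
      case False
      have i: "indep_vars (\<lambda>_. borel) X {l, l'}"
        using indep_vars_subset[OF indep, of "{l, l'}"] l by simp
      show ?thesis
        using indep_vars_lebesgue_integral[OF _ i] indep_vars_integrable[OF _ i] int1 l E1 False
        by auto
    qed
    then show "integrable M (\<lambda>\<omega>. X l \<omega> * X l' \<omega>)"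
      "expectation (\<lambda>\<omega>. X l \<omega> * X l' \<omega>) = (if l = l' then \<sigma>\<^sup>2 else 0)" by auto
  qed
  have expand: "(c \<bullet> e \<omega>)\<^sup>2 = (\<Sum>l<n. \<Sum>l'<n. c $ l * c $ l' * (X l \<omega> * X l' \<omega>))"
    if "\<omega> \<in> space M" for \<omega>
    using ec[OF that]
    by (simp add: X_def scalar_prod_def power2_eq_square sum_product atLeast0LessThan mult_ac)
  show "integrable M (\<lambda>\<omega>. (c \<bullet> e \<omega>)\<^sup>2)"
    using int by (subst Bochner_Integration.integrable_cong[OF refl expand])
      (auto intro!: Bochner_Integration.integrable_sum)
  have "expectation (\<lambda>\<omega>. (c \<bullet> e \<omega>)\<^sup>2)
      = expectation (\<lambda>\<omega>. \<Sum>l<n. \<Sum>l'<n. c $ l * c $ l' * (X l \<omega> * X l' \<omega>))"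
    by (rule Bochner_Integration.integral_cong[OF refl expand])
  also have "\<dots> = (\<Sum>l<n. \<Sum>l'<n. c $ l * c $ l' * (if l = l' then \<sigma>\<^sup>2 else 0))"
  proof -
    have "expectation (\<lambda>\<omega>. \<Sum>l<n. \<Sum>l'<n. c $ l * c $ l' * (X l \<omega> * X l' \<omega>))
        = (\<Sum>l<n. \<Sum>l'<n. expectation (\<lambda>\<omega>. c $ l * c $ l' * (X l \<omega> * X l' \<omega>)))"
      using int
      by (subst Bochner_Integration.integral_sum,
          force intro: Bochner_Integration.integrable_sum)
        (auto intro!: sum.cong Bochner_Integration.integral_sum)
    also have "\<dots> = (\<Sum>l<n. \<Sum>l'<n. c $ l * c $ l' * (if l = l' then \<sigma>\<^sup>2 else 0))"
      by (intro sum.cong refl) (simp only: lessThan_iff integral_mult_right_zero E)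
    finally show ?thesis .
  qed
  also have "\<dots> = (\<Sum>l<n. \<sigma>\<^sup>2 * (c $ l)\<^sup>2)"
    by (intro sum.cong) (auto simp: power2_eq_square if_distrib mult_ac cong: if_cong)
  finally show "expectation (\<lambda>\<omega>. (c \<bullet> e \<omega>)\<^sup>2) = \<sigma>\<^sup>2 * sq_l2_norm c"
    using c by (simp add: sq_l2_norm_def sum_distrib_left)
qed

section \<open>Propagation of the noise through the layers\<close>

theorem mainTheorem2:
  fixes n k :: nat
    and m s :: "nat \<Rightarrow> nat"
    and D :: "nat \<Rightarrow> real mat"
    and x :: "real vec"
    and \<gamma> :: "nat \<Rightarrow> real vec"
    and \<Lambda> :: "nat \<Rightarrow> nat set"
    and \<sigma> :: real
    and M :: "'a measure"
    and e y :: "'a \<Rightarrow> real vec"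
    and \<gamma>hat :: "'a \<Rightarrow> nat \<Rightarrow> real vec"
  assumes "D 1 \<in> carrier_mat n (m 1)"
    and "\<And>i. i \<in> {2..k} \<Longrightarrow> D i \<in> carrier_mat (m (i - 1)) (m i)"
    and "\<And>i. i \<in> {1..k} \<Longrightarrow> \<gamma> i \<in> carrier_vec (m i)"
    and "x = D 1 *\<^sub>v \<gamma> 1"
    and "\<And>i. i \<in> {2..k} \<Longrightarrow> \<gamma> (i - 1) = D i *\<^sub>v \<gamma> i"
    and "\<And>i. i \<in> {1..k} \<Longrightarrow> \<Lambda> i = supp_vec (\<gamma> i)"
    and "\<And>i. i \<in> {1..k} \<Longrightarrow> s i = card (\<Lambda> i)"
    and "prob_space M"
    and "\<sigma> > 0"
    and "white_gaussian M n \<sigma> e"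
    and "\<And>\<omega>. \<omega> \<in> space M \<Longrightarrow> y \<omega> = x + e \<omega>"
    and "\<And>j. j \<in> {1..k} \<Longrightarrow> rip_const (D j) (s j) < 1"
    and "\<And>\<omega>. \<omega> \<in> space M \<Longrightarrow> oracle_estimators k D \<Lambda> (y \<omega>) (\<gamma>hat \<omega>)"
  shows "\<forall>i\<in>{1..k}.
    integrable M (\<lambda>\<omega>. sq_l2_norm (\<gamma> i - \<gamma>hat \<omega> i)) \<and>
    ((\<forall>j\<in>{2..i}. 0 \<le> real (s (j - 1)) / real (m (j - 1)) - subset_rip_const (D j) (s (j - 1)) (s j)) \<or>
     (\<Prod>j = 2..i. (real (s (j - 1)) / real (m (j - 1)) - subset_rip_const (D j) (s (j - 1)) (s j))
                 / (1 + rip_const (D j) (s j))\<^sup>2) \<le> 0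
     \<longrightarrow>
     \<sigma>\<^sup>2 * real (s i) * (1 / (1 + rip_const (D 1) (s 1))) *
       (\<Prod>j = 2..i. (real (s (j - 1)) / real (m (j - 1)) - subset_rip_const (D j) (s (j - 1)) (s j))
                   / (1 + rip_const (D j) (s j))\<^sup>2)
       \<le> prob_space.expectation M (\<lambda>\<omega>. sq_l2_norm (\<gamma> i - \<gamma>hat \<omega> i))) \<and>
    prob_space.expectation M (\<lambda>\<omega>. sq_l2_norm (\<gamma> i - \<gamma>hat \<omega> i))
      \<le> \<sigma>\<^sup>2 * real (s i) * (1 / (1 - rip_const (D 1) (s 1))) *
        (\<Prod>j = 2..i. (real (s (j - 1)) / real (m (j - 1)) + subset_rip_const (D j) (s (j - 1)) (s j))
                    / (1 - rip_const (D j) (s j))\<^sup>2)"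
proof -
  interpret prob_space M by (rule assms(8))
  \<comment> \<open>\<open>p i\<close> and \<open>z i\<close> are the dimension and the error of the
    input of layer \<open>i\<close>. The case distinction lets layer 1, whose input is the noisy
    signal, share the facts about the other layers. The error is taken as estimate minus truth, so
    that \<open>z 1\<close> is \<open>e\<close> with the right sign.\<close>
  define p where "p i = (if i = 1 then n else m (i - 1))" for i :: nat
  define A where "A i = col_submatrix (D i) (\<Lambda> i)" for i
  define \<epsilon> where "\<epsilon> i \<omega> = \<gamma>hat \<omega> i - \<gamma> i" for i \<omega>
  define z where "z i \<omega> = (if i = 1 then e \<omega> else \<epsilon> (i - 1) \<omega>)" for i \<omega>
  define \<delta> where "\<delta> i = rip_const (D i) (s i)" for i
  define \<eta> where "\<eta> i = subset_rip_const (D i) (s (i - 1)) (s i)" for i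
  define q where "q i = real (s (i - 1)) / real (m (i - 1))" for i
  define Lo where "Lo i = 1 / (1 + \<delta> 1) * (\<Prod>j = 2..i. (q j - \<eta> j) / (1 + \<delta> j)\<^sup>2)" for i
  define Hi where "Hi i = 1 / (1 - \<delta> 1) * (\<Prod>j = 2..i. (q j + \<eta> j) / (1 - \<delta> j)\<^sup>2)" for i

  have Dc: "D i \<in> carrier_mat (p i) (m i)" if "i \<in> {1..k}" for i
    using assms(1,2) that unfolding p_def by (cases "i = 1") auto
  have \<gamma>c: "\<gamma> i \<in> carrier_vec (m i)" and \<Lambda>: "\<Lambda> i = supp_vec (\<gamma> i)" and s: "card (\<Lambda> i) = s i"
    and \<Lambda>_sub: "\<Lambda> i \<subseteq> {..<m i}" and \<delta>1: "0 < 1 - \<delta> i" if "i \<in> {1..k}" for i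
    using assms(3,6,7,12)[OF that] unfolding \<delta>_def by (auto simp: supp_vec_def)
  have \<delta>0: "0 < 1 + \<delta> i" if "i \<in> {1..k}" for i
    using rip_const_nonneg[OF Dc[OF that], of "s i"] unfolding \<delta>_def by simp
  have s_le: "s i \<le> m i" if "i \<in> {1..k}" for i
    using card_mono[OF _ \<Lambda>_sub[OF that]] s[OF that] by simp
  have Ac: "A i \<in> carrier_mat (p i) (s i)" if "i \<in> {1..k}" for i
    using col_submatrix_carrier[OF Dc[OF that] \<Lambda>_sub[OF that]] s[OF that] unfolding A_def by simp
  have bb: "bounded_below_mat (A i) (p i) (s i) (1 - \<delta> i)" if "i \<in> {1..k}" for i
    using Ac[OF that] \<delta>1[OF that] rip_const_lower[OF Dc[OF that] \<Lambda>_sub[OF that] s[OF that]]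
    unfolding A_def \<delta>_def by unfold_locales auto
  have upper: "sq_l2_norm (A i *\<^sub>v v) \<le> (1 + \<delta> i) * sq_l2_norm v"
    if "i \<in> {1..k}" "v \<in> carrier_vec (s i)" for i v
    using rip_const_upper[OF Dc[OF that(1)] \<Lambda>_sub[OF that(1)] s[OF that(1)] that(2)]
    unfolding A_def \<delta>_def by simp
  have A\<gamma>: "A i *\<^sub>v restrict_vec (\<gamma> i) (\<Lambda> i) = D i *\<^sub>v \<gamma> i" if "i \<in> {1..k}" for i
    unfolding A_def using \<Lambda>[OF that]
    by (intro col_submatrix_mult_restrict_vec[OF Dc[OF that] \<Lambda>_sub[OF that] \<gamma>c[OF that]]) simp
  have r\<gamma>: "restrict_vec (\<gamma> i) (\<Lambda> i) \<in> carrier_vec (s i)" if "i \<in> {1..k}" for i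
    using restrict_vec_carrier[OF \<gamma>c[OF that] \<Lambda>_sub[OF that]] s[OF that] by simp
  have ec: "e \<omega> \<in> carrier_vec n" if "\<omega> \<in> space M" for \<omega>
    using assms(10) that unfolding white_gaussian_def by auto
  have estimator: "\<gamma>hat \<omega> i \<in> carrier_vec (m i)" "supp_vec (\<gamma>hat \<omega> i) \<subseteq> \<Lambda> i"
    "restrict_vec (\<gamma>hat \<omega> i) (\<Lambda> i) = pseudo_inverse (A i) *\<^sub>v \<gamma>hat \<omega> (i - 1)" "\<gamma>hat \<omega> 0 = y \<omega>"
    if "i \<in> {1..k}" "\<omega> \<in> space M" for i \<omega>
    using assms(13)[OF that(2), unfolded oracle_estimators_def] that(1)
    unfolding A_def carrier_matD(2)[OF Dc[OF that(1)], symmetric] by blast+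
  have \<epsilon>c: "\<epsilon> i \<omega> \<in> carrier_vec (m i)" and \<epsilon>_supp: "supp_vec (\<epsilon> i \<omega>) \<subseteq> \<Lambda> i"
    if "i \<in> {1..k}" "\<omega> \<in> space M" for i \<omega>
    using estimator(1,2)[OF that] \<gamma>c[OF that(1)] \<Lambda>[OF that(1)]
    unfolding \<epsilon>_def supp_vec_def by auto
  have pred: "i - 1 \<in> {1..k}" if "i \<in> {1..k}" "i \<noteq> 1" for i
    using that by auto
  have zc: "z i \<omega> \<in> carrier_vec (p i)" if "i \<in> {1..k}" "\<omega> \<in> space M" for i \<omega>
    using ec[OF that(2)] \<epsilon>c[OF pred[OF that(1)] that(2)] that unfolding z_def p_def by simp
  have prev: "\<gamma>hat \<omega> (i - 1) \<in> carrier_vec (p i)" "z i \<omega> = \<gamma>hat \<omega> (i - 1) - D i *\<^sub>v \<gamma> i"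
    if "i \<in> {1..k}" "\<omega> \<in> space M" for i \<omega>
  proof -
    have x: "D 1 *\<^sub>v \<gamma> 1 \<in> carrier_vec n" if "1 \<in> {1..k}"
      using mult_mat_vec_carrier[OF assms(1) \<gamma>c[OF that]] .
    have "\<gamma>hat \<omega> (i - 1) \<in> carrier_vec (p i) \<and> z i \<omega> = \<gamma>hat \<omega> (i - 1) - D i *\<^sub>v \<gamma> i"
    proof (cases "i = 1")
      case True
      have "b = a + b - a" if "a \<in> carrier_vec n" "b \<in> carrier_vec n" for a b :: "real vec"
        using that by (intro eq_vecI) auto
      then have "e \<omega> = D 1 *\<^sub>v \<gamma> 1 + e \<omega> - D 1 *\<^sub>v \<gamma> 1"
        using x ec[OF that(2)] that(1) True by blast
      then show ?thesis
        using True x that estimator(4)[OF that] assms(4) assms(11)[OF that(2)] ec[OF that(2)]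
        by (simp add: p_def z_def)
    next
      case False
      then show ?thesis
        using that estimator(1)[OF pred[OF that(1) False] that(2)] assms(5)[of i] by (simp add: p_def z_def \<epsilon>_def)
    qed
    then show "\<gamma>hat \<omega> (i - 1) \<in> carrier_vec (p i)" "z i \<omega> = \<gamma>hat \<omega> (i - 1) - D i *\<^sub>v \<gamma> i" by auto
  qed
  \<comment> \<open>The linear error recursion: the true coefficients are the pseudo-inverse applied
    to the exact input \<open>D i *\<^sub>v \<gamma> i\<close>, so subtracting them from the
    estimate leaves the pseudo-inverse of the input error.\<close>
  have err: "restrict_vec (\<epsilon> i \<omega>) (\<Lambda> i) = pseudo_inverse (A i) *\<^sub>v z i \<omega>"
    if i: "i \<in> {1..k}" and \<omega>: "\<omega> \<in> space M" for i \<omega>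
  proof -
    interpret bounded_below_mat "A i" "p i" "s i" "1 - \<delta> i" by (rule bb[OF i])
    have "restrict_vec (\<epsilon> i \<omega>) (\<Lambda> i) = restrict_vec (\<gamma>hat \<omega> i) (\<Lambda> i) - restrict_vec (\<gamma> i) (\<Lambda> i)"
      unfolding \<epsilon>_def by (rule restrict_vec_minus[OF estimator(1)[OF i \<omega>] \<gamma>c[OF i] \<Lambda>_sub[OF i]])
    also have "restrict_vec (\<gamma> i) (\<Lambda> i) = pseudo_inverse (A i) *\<^sub>v (D i *\<^sub>v \<gamma> i)"
      using pseudo_inverse_mult_vec[OF r\<gamma>[OF i]] A\<gamma>[OF i] by simp
    also have "restrict_vec (\<gamma>hat \<omega> i) (\<Lambda> i) - pseudo_inverse (A i) *\<^sub>v (D i *\<^sub>v \<gamma> i)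
        = pseudo_inverse (A i) *\<^sub>v z i \<omega>"
      unfolding estimator(3)[OF i \<omega>] prev(2)[OF i \<omega>]
      by (rule mult_minus_distrib_mat_vec[OF pseudo_inverse_carrier prev(1)[OF i \<omega>]
            mult_mat_vec_carrier[OF Dc[OF i] \<gamma>c[OF i]], symmetric])
    finally show ?thesis .
  qed
  \<comment> \<open>If \<open>\<gamma> i\<close> were 0, injectivity of the next column submatrix
    would force \<open>\<gamma> (Suc i)\<close> to be 0. Nonempty support thus passes down to all
    earlier layers, which keeps the induction below away from unspecified subset RIP
    constants.\<close>
  have s_pos: "1 \<le> s i" if i: "i \<in> {1..k}" "Suc i \<in> {1..k}" and pos: "1 \<le> s (Suc i)" for i
  proof (rule ccontr)
    interpret bounded_below_mat "A (Suc i)" "p (Suc i)" "s (Suc i)" "1 - \<delta> (Suc i)" by (rule bb[OF i(2)])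
    assume "\<not> 1 \<le> s i"
    then have "card (\<Lambda> i) = 0" using s[OF i(1)] by simp
    then have "\<Lambda> i = {}" using finite_subset[OF \<Lambda>_sub[OF i(1)]] by simp
    then have "\<gamma> i = 0\<^sub>v (m i)"
      using \<Lambda>[OF i(1)] \<gamma>c[OF i(1)] unfolding supp_vec_def by (intro eq_vecI) auto
    then have "A (Suc i) *\<^sub>v restrict_vec (\<gamma> (Suc i)) (\<Lambda> (Suc i)) = 0\<^sub>v (p (Suc i))"
      using A\<gamma>[OF i(2)] assms(5)[of "Suc i"] i by (simp add: p_def)
    then have "restrict_vec (\<gamma> (Suc i)) (\<Lambda> (Suc i)) = 0\<^sub>v (s (Suc i))"
      by (rule mult_vec_eq_0[OF r\<gamma>[OF i(2)]])
    then have "sq_l2_norm (\<gamma> (Suc i)) = 0"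
      using sq_l2_norm_restrict_vec[OF \<gamma>c[OF i(2)] \<Lambda>_sub[OF i(2)]] \<Lambda>[OF i(2)]
        sq_l2_norm_eq_0_iff[OF r\<gamma>[OF i(2)]] by simp
    then have "\<Lambda> (Suc i) = {}"
      using sq_l2_norm_eq_0_iff[OF \<gamma>c[OF i(2)]] \<Lambda>[OF i(2)] by (auto simp: supp_vec_def)
    then show False using s[OF i(2)] pos by simp
  qed

  \<comment> \<open>The claim covers all \<open>u\<close>, not just coordinate vectors, because the
    induction step replaces \<open>u\<close> by a vector \<open>v\<close> of the preceding layer
    that need not be a coordinate vector. Nonnegativity of \<open>Hi i\<close> is carried along
    since norm estimates get multiplied by it.\<close>
  have functional: "0 \<le> Hi i \<and> (\<forall>u\<in>carrier_vec (s i). \<exists>c\<in>carrier_vec n.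
      (\<forall>\<omega>\<in>space M. u \<bullet> restrict_vec (\<epsilon> i \<omega>) (\<Lambda> i) = c \<bullet> e \<omega>) \<and>
      sq_l2_norm c \<le> Hi i * sq_l2_norm u \<and>
      ((\<forall>j\<in>{2..i}. 0 \<le> q j - \<eta> j) \<longrightarrow> Lo i * sq_l2_norm u \<le> sq_l2_norm c))"
    if "1 \<le> i" "i \<le> k" "1 \<le> s i" for i
    using that
  proof (induction i rule: dec_induct)
    case base
    then have i: "1 \<in> {1..k}" by simp
    interpret bounded_below_mat "A 1" "p 1" "s 1" "1 - \<delta> 1" by (rule bb[OF i])
    show ?case
    proof (intro conjI ballI)
      show "0 \<le> Hi 1" using \<delta>1[OF i] by (simp add: Hi_def)
      fix u :: "real vec" assume u: "u \<in> carrier_vec (s 1)"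
      \<comment> \<open>The noise is not confined to a support, so no rows are discarded: the
        coefficient vector is \<open>A 1 *\<^sub>v w\<close> itself. Comparing its norm directly
        with that of \<open>u\<close> costs only the first power of \<open>1 + \<delta> 1\<close> or
        \<open>1 - \<delta> 1\<close>.\<close>
      obtain w where w: "w \<in> carrier_vec (s 1)" "transpose_mat (A 1) *\<^sub>v (A 1 *\<^sub>v w) = u"
        "(1 - \<delta> 1) * sq_l2_norm (A 1 *\<^sub>v w) \<le> sq_l2_norm u"
        "sq_l2_norm u \<le> (1 + \<delta> 1) * sq_l2_norm (A 1 *\<^sub>v w)"
        using gram_solution[OF u \<delta>0[OF i] upper[OF i]] by metis
      show "\<exists>c\<in>carrier_vec n. (\<forall>\<omega>\<in>space M. u \<bullet> restrict_vec (\<epsilon> 1 \<omega>) (\<Lambda> 1) = c \<bullet> e \<omega>) \<and>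
          sq_l2_norm c \<le> Hi 1 * sq_l2_norm u \<and>
          ((\<forall>j\<in>{2..1}. 0 \<le> q j - \<eta> j) \<longrightarrow> Lo 1 * sq_l2_norm u \<le> sq_l2_norm c)"
      proof (intro bexI[of _ "A 1 *\<^sub>v w"] conjI impI ballI)
        show "A 1 *\<^sub>v w \<in> carrier_vec n"
          using mult_mat_vec_carrier[OF Ac[OF i] w(1)] by (simp add: p_def)
        show "u \<bullet> restrict_vec (\<epsilon> 1 \<omega>) (\<Lambda> 1) = (A 1 *\<^sub>v w) \<bullet> e \<omega>" if "\<omega> \<in> space M" for \<omega>
          using scalar_prod_pseudo_inverse[OF w(1) zc[OF i that]] w(2) err[OF i that]
          by (simp add: z_def)
        show "sq_l2_norm (A 1 *\<^sub>v w) \<le> Hi 1 * sq_l2_norm u"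
          using w(3) \<delta>1[OF i] by (simp add: Hi_def pos_le_divide_eq mult_ac)
        show "Lo 1 * sq_l2_norm u \<le> sq_l2_norm (A 1 *\<^sub>v w)"
          using w(4) \<delta>0[OF i] by (simp add: Lo_def pos_divide_le_eq mult_ac)
      qed
    qed
  next
    case (step i)
    let ?i = "Suc i"
    have i: "i \<in> {1..k}" and i': "?i \<in> {1..k}" using step by auto
    have si: "1 \<le> s i" by (rule s_pos[OF i i' step.prems(2)])
    have IH: "0 \<le> Hi i" "\<And>u. u \<in> carrier_vec (s i) \<Longrightarrow> \<exists>c\<in>carrier_vec n.
      (\<forall>\<omega>\<in>space M. u \<bullet> restrict_vec (\<epsilon> i \<omega>) (\<Lambda> i) = c \<bullet> e \<omega>) \<and>
      sq_l2_norm c \<le> Hi i * sq_l2_norm u \<and>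
      ((\<forall>j\<in>{2..i}. 0 \<le> q j - \<eta> j) \<longrightarrow> Lo i * sq_l2_norm u \<le> sq_l2_norm c)"
      using step.IH si step.prems by auto
    interpret bounded_below_mat "A ?i" "p ?i" "s ?i" "1 - \<delta> ?i" by (rule bb[OF i'])
    have D': "D ?i \<in> carrier_mat (m i) (m ?i)" and pi: "p ?i = m i"
      using Dc[OF i'] i by (auto simp: p_def)
    have Hi_Suc: "Hi ?i = Hi i * ((q ?i + \<eta> ?i) / (1 - \<delta> ?i)\<^sup>2)"
      and Lo_Suc: "Lo ?i = Lo i * ((q ?i - \<eta> ?i) / (1 + \<delta> ?i)\<^sup>2)"
      using i by (simp_all add: Hi_def Lo_def)
    \<comment> \<open>This sum bounds a squared norm from above, hence its sign;
      \<open>q ?i - \<eta> ?i\<close> has no such guarantee, which is why the lower estimate carries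
      a guard.\<close>
    have q\<eta>: "0 \<le> q ?i + \<eta> ?i"
      using subset_rip_const_upper_nonneg[OF D' s_le[OF i] step.prems(2) s_le[OF i']]
      by (simp add: q_def \<eta>_def)
    show ?case
    proof (intro conjI ballI)
      show "0 \<le> Hi ?i" unfolding Hi_Suc using IH(1) q\<eta> by simp
      fix u :: "real vec" assume u: "u \<in> carrier_vec (s ?i)"
      \<comment> \<open>Now |w| is compared with |u|, since the subset RIP constant measures the
        restricted image against |w|. This is the origin of the squares in the denominators.\<close>
      obtain w where w: "w \<in> carrier_vec (s ?i)" "transpose_mat (A ?i) *\<^sub>v (A ?i *\<^sub>v w) = u"
        "(1 - \<delta> ?i)\<^sup>2 * sq_l2_norm w \<le> sq_l2_norm u"
        "sq_l2_norm u \<le> (1 + \<delta> ?i)\<^sup>2 * sq_l2_norm w"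
        using gram_solution[OF u \<delta>0[OF i'] upper[OF i']] by metis
      define v where "v = restrict_vec (A ?i *\<^sub>v w) (\<Lambda> i)"
      have Aw: "A ?i *\<^sub>v w \<in> carrier_vec (m i)"
        using mult_mat_vec_carrier[OF Ac[OF i'] w(1)] pi by simp
      have v: "v \<in> carrier_vec (s i)"
        unfolding v_def using restrict_vec_carrier[OF Aw \<Lambda>_sub[OF i]] s[OF i] by simp
      have vS: "v = submatrix (D ?i) (\<Lambda> i) (\<Lambda> ?i) *\<^sub>v w"
        unfolding v_def A_def
        using submatrix_mult_vec[OF D' \<Lambda>_sub[OF i] \<Lambda>_sub[OF i'], of w] w(1) s[OF i'] by simp
      have v_upper: "sq_l2_norm v \<le> (q ?i + \<eta> ?i) * sq_l2_norm w"
        using subset_rip_const_upper[OF D' s_le[OF i] step.prems(2) s_le[OF i']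
            \<Lambda>_sub[OF i] s[OF i] \<Lambda>_sub[OF i'] s[OF i'] w(1)]
        by (simp add: vS q_def \<eta>_def)
      have v_lower: "(q ?i - \<eta> ?i) * sq_l2_norm w \<le> sq_l2_norm v"
        using subset_rip_const_lower[OF D' s_le[OF i] step.prems(2) s_le[OF i']
            \<Lambda>_sub[OF i] s[OF i] \<Lambda>_sub[OF i'] s[OF i'] w(1)]
        by (simp add: vS q_def \<eta>_def)
      obtain c where c: "c \<in> carrier_vec n"
        "\<And>\<omega>. \<omega> \<in> space M \<Longrightarrow> v \<bullet> restrict_vec (\<epsilon> i \<omega>) (\<Lambda> i) = c \<bullet> e \<omega>"
        "sq_l2_norm c \<le> Hi i * sq_l2_norm v"
        "(\<forall>j\<in>{2..i}. 0 \<le> q j - \<eta> j) \<Longrightarrow> Lo i * sq_l2_norm v \<le> sq_l2_norm c"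
        using IH(2)[OF v] by blast
      show "\<exists>c\<in>carrier_vec n. (\<forall>\<omega>\<in>space M. u \<bullet> restrict_vec (\<epsilon> ?i \<omega>) (\<Lambda> ?i) = c \<bullet> e \<omega>) \<and>
          sq_l2_norm c \<le> Hi ?i * sq_l2_norm u \<and>
          ((\<forall>j\<in>{2..?i}. 0 \<le> q j - \<eta> j) \<longrightarrow> Lo ?i * sq_l2_norm u \<le> sq_l2_norm c)"
      \<comment> \<open>The coefficient vector of \<open>v\<close> at layer \<open>i\<close> also
        represents \<open>u\<close> at the next layer, because \<open>\<epsilon> i\<close> vanishes
        outside \<open>\<Lambda> i\<close>.\<close>
      proof (intro bexI[of _ c] conjI impI ballI)
        show "c \<in> carrier_vec n" by (rule c(1))
        show "u \<bullet> restrict_vec (\<epsilon> ?i \<omega>) (\<Lambda> ?i) = c \<bullet> e \<omega>" if \<omega>: "\<omega> \<in> space M" for \<omega>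
        proof -
          have "u \<bullet> restrict_vec (\<epsilon> ?i \<omega>) (\<Lambda> ?i) = (A ?i *\<^sub>v w) \<bullet> z ?i \<omega>"
            using scalar_prod_pseudo_inverse[OF w(1) zc[OF i' \<omega>]] w(2) err[OF i' \<omega>] by simp
          also have "z ?i \<omega> = \<epsilon> i \<omega>" using i by (simp add: z_def)
          also have "(A ?i *\<^sub>v w) \<bullet> \<epsilon> i \<omega> = v \<bullet> restrict_vec (\<epsilon> i \<omega>) (\<Lambda> i)"
            unfolding v_def
            by (rule scalar_prod_restrict_vec[OF Aw \<epsilon>c[OF i \<omega>] \<Lambda>_sub[OF i] \<epsilon>_supp[OF i \<omega>], symmetric])
          finally show ?thesis using c(2)[OF \<omega>] by simp
        qed
        have "sq_l2_norm w \<le> sq_l2_norm u / (1 - \<delta> ?i)\<^sup>2"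
          using w(3) \<delta>1[OF i'] by (simp add: pos_le_divide_eq mult_ac)
        then have "(q ?i + \<eta> ?i) * sq_l2_norm w \<le> (q ?i + \<eta> ?i) * (sq_l2_norm u / (1 - \<delta> ?i)\<^sup>2)"
          by (rule mult_left_mono[OF _ q\<eta>])
        then have "Hi i * sq_l2_norm v \<le> Hi i * ((q ?i + \<eta> ?i) * (sq_l2_norm u / (1 - \<delta> ?i)\<^sup>2))"
          using v_upper by (intro mult_left_mono[OF _ IH(1)]) linarith
        then show "sq_l2_norm c \<le> Hi ?i * sq_l2_norm u"
          using c(3) by (simp add: Hi_Suc)
        assume g: "\<forall>j\<in>{2..?i}. 0 \<le> q j - \<eta> j"
        then have g': "\<forall>j\<in>{2..i}. 0 \<le> q j - \<eta> j" and gi: "0 \<le> q ?i - \<eta> ?i" using i by auto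
        \<comment> \<open>Both signs matter: the estimate for |w| is multiplied by
          \<open>q ?i - \<eta> ?i\<close>, and the one for |v| by \<open>Lo i\<close>. Either
          inequality would reverse for a negative multiplier.\<close>
        have Lo0: "0 \<le> Lo i"
          unfolding Lo_def using g' \<delta>0[of 1] i by (intro mult_nonneg_nonneg prod_nonneg) auto
        have "sq_l2_norm u / (1 + \<delta> ?i)\<^sup>2 \<le> sq_l2_norm w"
          using w(4) \<delta>0[OF i'] by (simp add: pos_divide_le_eq mult_ac)
        then have "(q ?i - \<eta> ?i) * (sq_l2_norm u / (1 + \<delta> ?i)\<^sup>2) \<le> (q ?i - \<eta> ?i) * sq_l2_norm w"
          by (rule mult_left_mono[OF _ gi])
        then have "Lo i * ((q ?i - \<eta> ?i) * (sq_l2_norm u / (1 + \<delta> ?i)\<^sup>2)) \<le> Lo i * sq_l2_norm v"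
          using v_lower by (intro mult_left_mono[OF _ Lo0]) linarith
        then show "Lo ?i * sq_l2_norm u \<le> sq_l2_norm c"
          using c(4)[OF g'] by (simp add: Lo_Suc)
      qed
    qed
  qed

  \<comment> \<open>Integrability accompanies the bounds because the integral of a non-integrable
    function is 0 by default, which would make the upper bound uninformative.\<close>
  have main: "integrable M (\<lambda>\<omega>. sq_l2_norm (\<gamma> i - \<gamma>hat \<omega> i)) \<and>
      ((\<forall>j\<in>{2..i}. 0 \<le> q j - \<eta> j) \<or> (\<Prod>j = 2..i. (q j - \<eta> j) / (1 + \<delta> j)\<^sup>2) \<le> 0 \<longrightarrow>
        \<sigma>\<^sup>2 * real (s i) * Lo i \<le> expectation (\<lambda>\<omega>. sq_l2_norm (\<gamma> i - \<gamma>hat \<omega> i))) \<and>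
      expectation (\<lambda>\<omega>. sq_l2_norm (\<gamma> i - \<gamma>hat \<omega> i)) \<le> \<sigma>\<^sup>2 * real (s i) * Hi i"
    if i: "i \<in> {1..k}" for i
  proof -
    let ?E = "expectation (\<lambda>\<omega>. sq_l2_norm (\<gamma> i - \<gamma>hat \<omega> i))"
    \<comment> \<open>Coordinate functionals correspond to unit vectors, of norm 1. An index
      \<open>r < s i\<close> provides the premise \<open>1 \<le> s i\<close>; for empty support the
      sums below are empty, and the expectation and both bounds are 0.\<close>
    have "\<exists>c\<in>carrier_vec n.
        (\<forall>\<omega>\<in>space M. unit_vec (s i) r \<bullet> restrict_vec (\<epsilon> i \<omega>) (\<Lambda> i) = c \<bullet> e \<omega>) \<and>
        sq_l2_norm c \<le> Hi i \<and> ((\<forall>j\<in>{2..i}. 0 \<le> q j - \<eta> j) \<longrightarrow> Lo i \<le> sq_l2_norm c)"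
      if r: "r < s i" for r
      using functional[of i] i r
      by (auto simp: sq_l2_norm_scalar_prod dest!: bspec[where x = "unit_vec (s i) r"])
    then obtain c where c: "\<And>r. r < s i \<Longrightarrow> c r \<in> carrier_vec n"
      "\<And>r \<omega>. r < s i \<Longrightarrow> \<omega> \<in> space M \<Longrightarrow>
        unit_vec (s i) r \<bullet> restrict_vec (\<epsilon> i \<omega>) (\<Lambda> i) = c r \<bullet> e \<omega>"
      "\<And>r. r < s i \<Longrightarrow> sq_l2_norm (c r) \<le> Hi i"
      "\<And>r. r < s i \<Longrightarrow> \<forall>j\<in>{2..i}. 0 \<le> q j - \<eta> j \<Longrightarrow> Lo i \<le> sq_l2_norm (c r)"
      by metis
    have eq: "sq_l2_norm (\<gamma> i - \<gamma>hat \<omega> i) = (\<Sum>r<s i. (c r \<bullet> e \<omega>)\<^sup>2)" if \<omega>: "\<omega> \<in> space M" for \<omega>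
    proof -
      have R: "restrict_vec (\<epsilon> i \<omega>) (\<Lambda> i) \<in> carrier_vec (s i)"
        using restrict_vec_carrier[OF \<epsilon>c[OF i \<omega>] \<Lambda>_sub[OF i]] s[OF i] by simp
      have "sq_l2_norm (\<gamma> i - \<gamma>hat \<omega> i) = sq_l2_norm (\<epsilon> i \<omega>)"
        using \<gamma>c[OF i] estimator(1)[OF i \<omega>]
        by (simp add: sq_l2_norm_def \<epsilon>_def power2_commute)
      also have "\<dots> = sq_l2_norm (restrict_vec (\<epsilon> i \<omega>) (\<Lambda> i))"
        by (rule sq_l2_norm_restrict_vec[OF \<epsilon>c[OF i \<omega>] \<Lambda>_sub[OF i] \<epsilon>_supp[OF i \<omega>], symmetric])
      also have "\<dots> = (\<Sum>r<s i. (unit_vec (s i) r \<bullet> restrict_vec (\<epsilon> i \<omega>) (\<Lambda> i))\<^sup>2)"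
        using R by (simp add: sq_l2_norm_def)
      finally show ?thesis using c(2)[OF _ \<omega>] by simp
    qed
    note moment = white_gaussian_integrable[OF assms(8-10)] white_gaussian_expectation[OF assms(8-10)]
    have int: "integrable M (\<lambda>\<omega>. sq_l2_norm (\<gamma> i - \<gamma>hat \<omega> i))"
      using moment(1) c(1) by (subst Bochner_Integration.integrable_cong[OF refl eq]) auto
    have "?E = expectation (\<lambda>\<omega>. \<Sum>r<s i. (c r \<bullet> e \<omega>)\<^sup>2)"
      by (rule Bochner_Integration.integral_cong[OF refl eq])
    also have "\<dots> = (\<Sum>r<s i. \<sigma>\<^sup>2 * sq_l2_norm (c r))"
      using moment c(1) by (subst Bochner_Integration.integral_sum) (auto intro!: sum.cong)
    finally have E: "?E = \<sigma>\<^sup>2 * (\<Sum>r<s i. sq_l2_norm (c r))" by (simp add: sum_distrib_left)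
    have "?E \<le> \<sigma>\<^sup>2 * (\<Sum>r<s i. Hi i)"
      unfolding E using c(3) by (intro mult_left_mono sum_mono) auto
    then have up: "?E \<le> \<sigma>\<^sup>2 * real (s i) * Hi i" by simp
    have low: "\<sigma>\<^sup>2 * real (s i) * Lo i \<le> ?E" if "\<forall>j\<in>{2..i}. 0 \<le> q j - \<eta> j"
    proof -
      have "\<sigma>\<^sup>2 * (\<Sum>r<s i. Lo i) \<le> ?E"
        unfolding E using c(4)[OF _ that] by (intro mult_left_mono sum_mono) auto
      then show ?thesis by simp
    qed
    \<comment> \<open>Here the claimed lower bound is at most 0, whereas the expected squared error
      is nonnegative; no layer-wise estimate enters.\<close>
    have low0: "\<sigma>\<^sup>2 * real (s i) * Lo i \<le> ?E" if "(\<Prod>j = 2..i. (q j - \<eta> j) / (1 + \<delta> j)\<^sup>2) \<le> 0"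
    proof -
      have "Lo i \<le> 0" unfolding Lo_def using that \<delta>0[of 1] i by (intro mult_nonneg_nonpos) auto
      then have "\<sigma>\<^sup>2 * real (s i) * Lo i \<le> 0" by (intro mult_nonneg_nonpos) auto
      also have "0 \<le> ?E" unfolding E by (intro mult_nonneg_nonneg sum_nonneg sq_l2_norm_nonneg) auto
      finally show ?thesis .
    qed
    show ?thesis using int up low low0 by blast
  qed
  show ?thesis
    using main unfolding Lo_def Hi_def q_def \<eta>_def \<delta>_def mult.assoc by blast
qed

end
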